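(* Let $\Omega\subset\mathbb{C}$ be a connected open set. For each $i=1,\dots,n$, let $X_i=(f_i,h_i):\Omega\to\mathbb{C}\times\mathbb{R}$ be a harmonic Enneper immersion, where $f_i:\Omega\to\mathbb{C}$ and $h_i:\Omega\to\mathbb{R}$ are harmonic functions. Assume that all $f_i$ have the same complex dilatation $\nu=\overline{(f_i)_{\bar z}}/(f_i)_z$, and let $a_i,b_i\in\mathbb{R}$ ($i=1,\dots,n$) be constants such that $\sum_{i=1}^n a_i f_i\neq 0$. Then the map $X:\Omega\to\mathbb{C}\times\mathbb{R}$ defined by $$X=\left(\sum_{i=1}^n a_i f_i,\ \sum_{i=1}^n b_i h_i\right)$$ is a harmonic Enneper immersion on $\Omega$. Moreover, writing $f_i=L_i+\overline{P_i}$ with $L_i,P_i$ holomorphic on $\Omega$, we have $$X=\left(\sum_{i=1}^n a_i L_i+\sum_{i=1}^n a_i\overline{P_i},\ \sum_{i=1}^n b_i h_i\right).$$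
   Context: Identify $\mathbb{R}^2$ with $\mathbb{C}$ via $z=x+iy$ and $\mathbb{R}^3$ with $\mathbb{C}\times\mathbb{R}$. Wirtinger derivatives: $\partial_z=\frac12(\partial_x-i\partial_y)$, $\partial_{\bar z}=\frac12(\partial_x+i\partial_y)$; subscripts $z,\bar z$ denote these derivatives. A harmonic immersion is an immersion $X:\Omega\to\mathbb{R}^3$ all of whose coordinate functions are harmonic. A harmonic Enneper immersion on $\Omega$ is a map $X=(f,h):\Omega\to\mathbb{C}\times\mathbb{R}$ with $h:\Omega\to\mathbb{R}$ harmonic and $f=L+\overline{P}$, where $L,P$ are holomorphic on $\Omega$ and satisfy $|L_z|\neq|P_z|$ at every point of $\Omega$ (this makes $X$ an immersion; its Hopf differential is then $\mathfrak{H}=L_zP_z+(h_z)^2$). For a harmonic function $f=L+\overline{P}$ with $L,P$ holomorphic, the complex (analytic) dilatation is $\nu_f=\overline{f_{\bar z}}/f_z=P_z/L_z$.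
   Formalization: Besides Σ a_i f_i ≠ 0, it is assumed that the z- and z̄-derivatives of Σ a_i f_i never vanish simultaneously on Ω; without this the claim fails, e.g. f_1 = z+1, f_2 = z, a = (1,−1). The dilatation may take the value ∞. *)

theory Defs
  imports "HOL-Complex_Analysis.Complex_Analysis"
begin

definition partial_x :: "(complex \<Rightarrow> 'a::real_normed_vector) \<Rightarrow> complex \<Rightarrow> 'a" where
  "partial_x f z = frechet_derivative f (at z) 1"

definition partial_y :: "(complex \<Rightarrow> 'a::real_normed_vector) \<Rightarrow> complex \<Rightarrow> 'a" where
  "partial_y f z = frechet_derivative f (at z) \<i>"

definition wirtinger :: "(complex \<Rightarrow> complex) \<Rightarrow> complex \<Rightarrow> complex" where
  "wirtinger f z = (1/2) * (partial_x f z - \<i> * partial_y f z)"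

definition wirtinger_bar :: "(complex \<Rightarrow> complex) \<Rightarrow> complex \<Rightarrow> complex" where
  "wirtinger_bar f z = (1/2) * (partial_x f z + \<i> * partial_y f z)"

(* Meant for open S only: the derivatives are taken at z, not within S. *)
definition C1_on :: "complex set \<Rightarrow> (complex \<Rightarrow> 'a::real_normed_vector) \<Rightarrow> bool" where
  "C1_on S f \<longleftrightarrow> (\<forall>z\<in>S. f differentiable (at z)) \<and>
     continuous_on S (partial_x f) \<and> continuous_on S (partial_y f)"

definition harmonic_on :: "complex set \<Rightarrow> (complex \<Rightarrow> 'a::real_normed_vector) \<Rightarrow> bool" where
  "harmonic_on S f \<longleftrightarrow> C1_on S f \<and> C1_on S (partial_x f) \<and> C1_on S (partial_y f) \<and>
     (\<forall>z\<in>S. partial_x (partial_x f) z + partial_y (partial_y f) z = 0)"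

definition harmonic_enneper_immersion :: "complex set \<Rightarrow> (complex \<Rightarrow> complex \<times> real) \<Rightarrow> bool" where
  "harmonic_enneper_immersion S X \<longleftrightarrow>
     harmonic_on S (\<lambda>z. snd (X z)) \<and>
     (\<exists>L P. L holomorphic_on S \<and> P holomorphic_on S \<and>
        (\<forall>z\<in>S. fst (X z) = L z + cnj (P z)) \<and>
        (\<forall>z\<in>S. cmod (wirtinger L z) \<noteq> cmod (wirtinger P z)))"

(* The dilatation takes values in the extended complex plane, with None standing for infinity:
   cmod L_z \<noteq> cmod P_z allows L_z to vanish where P_z does not, and there the library
   convention x / 0 = 0 would confuse the value infinity with the value 0.  The indeterminate
   case 0 / 0 also yields None; it does not occur for harmonic Enneper immersions. *)
definition complex_dilatation :: "(complex \<Rightarrow> complex) \<Rightarrow> complex \<Rightarrow> complex option" where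
  "complex_dilatation f z =
     (if wirtinger f z = 0 then None else Some (cnj (wirtinger_bar f z) / wirtinger f z))"

(* The differential of f vanishes nowhere on S, so that the quotient
   cnj f_zbar / f_z is at no point of S the indeterminate 0 / 0.  For linear combinations of
   harmonic functions with a common dilatation this does not follow from being nonzero:
   (z + 1) - z = 1 is nowhere zero, but constant. *)
definition nondegenerate_on :: "complex set \<Rightarrow> (complex \<Rightarrow> complex) \<Rightarrow> bool" where
  "nondegenerate_on S f \<longleftrightarrow> (\<forall>z\<in>S. wirtinger f z \<noteq> 0 \<or> wirtinger_bar f z \<noteq> 0)"

end

theory Submission
  imports Defs
begin

text \<open>
  At a point \<open>z\<close> the common dilatation forces the pairs of derivatives of \<open>L\<^sub>i\<close> and \<open>P\<^sub>i\<close> to lie on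
  one complex line through the origin of \<open>\<complex>\<^sup>2\<close>, and this line does not meet the set where both
  entries have the same positive modulus. The pair belonging to \<open>\<Sum>\<^sub>i a\<^sub>i f\<^sub>i\<close> is a real linear combination of the
  given ones, so it lies on the same line; by nondegeneracy it is not the origin, hence its two
  entries have different moduli.
\<close>

text \<open>\<open>frechet_derivative\<close> is a choice from the predicate
  \<open>has_derivative\<close>. Having a given derivative at \<open>z\<close> depends only on the
  germ there, so \<open>f\<close> and \<open>g\<close> yield the same predicate and hence the same
  choice, even at points where neither is differentiable.\<close>

lemma frechet_derivative_cong:
  assumes "open S" "z \<in> S" "\<And>w. w \<in> S \<Longrightarrow> f w = g w"
  shows "frechet_derivative f (at z) = frechet_derivative g (at z)"
proof -
  have "(f has_derivative D) (at z) \<longleftrightarrow> (g has_derivative D) (at z)" for D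
    using assms by (metis has_derivative_transform_within_open)
  then show ?thesis
    by (simp add: frechet_derivative_def)
qed

lemma partial_cong:
  assumes "open S" "z \<in> S" "\<And>w. w \<in> S \<Longrightarrow> f w = g w"
  shows "partial_x f z = partial_x g z" and "partial_y f z = partial_y g z"
  using frechet_derivative_cong[OF assms] by (simp_all add: partial_x_def partial_y_def)

lemma C1_on_cong:
  assumes "open S" "\<And>z. z \<in> S \<Longrightarrow> f z = g z"
  shows "C1_on S f \<longleftrightarrow> C1_on S g"
proof -
  have "f differentiable (at z) \<longleftrightarrow> g differentiable (at z)" if "z \<in> S" for z
    unfolding differentiable_def using assms that
    by (metis has_derivative_transform_within_open)
  moreover have "continuous_on S (partial_x f) \<longleftrightarrow> continuous_on S (partial_x g)"
    "continuous_on S (partial_y f) \<longleftrightarrow> continuous_on S (partial_y g)"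
    using partial_cong[of S _ f g] assms by (auto intro!: continuous_on_cong)
  ultimately show ?thesis
    by (auto simp: C1_on_def)
qed

lemma harmonic_on_cong:
  assumes "open S" and eq: "\<And>z. z \<in> S \<Longrightarrow> f z = g z"
  shows "harmonic_on S f \<longleftrightarrow> harmonic_on S g"
proof -
  have x: "partial_x f z = partial_x g z" and y: "partial_y f z = partial_y g z" if "z \<in> S" for z
    using partial_cong[OF \<open>open S\<close> that] eq by auto
  \<comment> \<open>The first partials agree on all of the open set \<open>S\<close>, not just at
    \<open>z\<close>, so the congruence can be applied to them once more.\<close>
  have "partial_x (partial_x f) z = partial_x (partial_x g) z"
    "partial_y (partial_y f) z = partial_y (partial_y g) z" if "z \<in> S" for z
    using partial_cong[OF \<open>open S\<close> that] x y by auto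
  then show ?thesis
    using C1_on_cong[OF \<open>open S\<close>, of f g] C1_on_cong[OF \<open>open S\<close>, of "partial_x f" "partial_x g"]
      C1_on_cong[OF \<open>open S\<close>, of "partial_y f" "partial_y g"] eq x y
    by (auto simp: harmonic_on_def)
qed

lemma partial_sum_scaleR:
  assumes "\<And>i. i \<in> I \<Longrightarrow> f i differentiable (at z)"
  shows "partial_x (\<lambda>w. \<Sum>i\<in>I. c i *\<^sub>R f i w) z = (\<Sum>i\<in>I. c i *\<^sub>R partial_x (f i) z)"
    and "partial_y (\<lambda>w. \<Sum>i\<in>I. c i *\<^sub>R f i w) z = (\<Sum>i\<in>I. c i *\<^sub>R partial_y (f i) z)"
proof -
  have "((\<lambda>w. \<Sum>i\<in>I. c i *\<^sub>R f i w) has_derivative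
      (\<lambda>v. \<Sum>i\<in>I. c i *\<^sub>R frechet_derivative (f i) (at z) v)) (at z)"
    using assms
    by (intro has_derivative_sum has_derivative_scaleR_right)
       (simp add: frechet_derivative_works)
  from frechet_derivative_at[OF this, symmetric]
  show "partial_x (\<lambda>w. \<Sum>i\<in>I. c i *\<^sub>R f i w) z = (\<Sum>i\<in>I. c i *\<^sub>R partial_x (f i) z)"
    and "partial_y (\<lambda>w. \<Sum>i\<in>I. c i *\<^sub>R f i w) z = (\<Sum>i\<in>I. c i *\<^sub>R partial_y (f i) z)"
    by (simp_all add: partial_x_def partial_y_def)
qed

lemma C1_on_sum_scaleR:
  assumes "\<And>i. i \<in> I \<Longrightarrow> C1_on S (f i)"
  shows "C1_on S (\<lambda>z. \<Sum>i\<in>I. c i *\<^sub>R f i z)"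
proof -
  have diff: "f i differentiable (at z)" if "i \<in> I" "z \<in> S" for i z
    using assms that by (auto simp: C1_on_def)
  have "(\<lambda>z. \<Sum>i\<in>I. c i *\<^sub>R f i z) differentiable (at z)" if "z \<in> S" for z
    using that diff
    by (intro differentiableI[where f' = "\<lambda>v. \<Sum>i\<in>I. c i *\<^sub>R frechet_derivative (f i) (at z) v"]
        has_derivative_sum has_derivative_scaleR_right)
       (simp add: frechet_derivative_works)
  \<comment> \<open>Differentiability is known on \<open>S\<close> only, so termwise differentiation
    is an identity on \<open>S\<close> rather than of functions; continuity is transferred
    accordingly.\<close>
  moreover have "continuous_on S (partial_x (\<lambda>z. \<Sum>i\<in>I. c i *\<^sub>R f i z)) \<longleftrightarrow>
      continuous_on S (\<lambda>z. \<Sum>i\<in>I. c i *\<^sub>R partial_x (f i) z)"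
    "continuous_on S (partial_y (\<lambda>z. \<Sum>i\<in>I. c i *\<^sub>R f i z)) \<longleftrightarrow>
      continuous_on S (\<lambda>z. \<Sum>i\<in>I. c i *\<^sub>R partial_y (f i) z)"
    using diff by (auto intro!: continuous_on_cong simp: partial_sum_scaleR)
  moreover have "continuous_on S (\<lambda>z. \<Sum>i\<in>I. c i *\<^sub>R partial_x (f i) z)"
    "continuous_on S (\<lambda>z. \<Sum>i\<in>I. c i *\<^sub>R partial_y (f i) z)"
    using assms by (auto intro!: continuous_intros simp: C1_on_def)
  ultimately show ?thesis
    by (simp add: C1_on_def)
qed

lemma harmonic_on_sum_scaleR:
  assumes "open S" and harm: "\<And>i. i \<in> I \<Longrightarrow> harmonic_on S (f i)"
  shows "harmonic_on S (\<lambda>z. \<Sum>i\<in>I. c i *\<^sub>R f i z)"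
proof -
  let ?g = "\<lambda>z. \<Sum>i\<in>I. c i *\<^sub>R f i z"
  have C1: "C1_on S (f i)" "C1_on S (partial_x (f i))" "C1_on S (partial_y (f i))" if "i \<in> I" for i
    using harm[OF that] by (auto simp: harmonic_on_def)
  have diff: "f i differentiable (at z)" "partial_x (f i) differentiable (at z)"
    "partial_y (f i) differentiable (at z)" if "i \<in> I" "z \<in> S" for i z
    using C1[OF that(1)] that(2) by (auto simp: C1_on_def)
  have x: "partial_x ?g z = (\<Sum>i\<in>I. c i *\<^sub>R partial_x (f i) z)"
    and y: "partial_y ?g z = (\<Sum>i\<in>I. c i *\<^sub>R partial_y (f i) z)" if "z \<in> S" for z
    using diff that by (simp_all add: partial_sum_scaleR)
  have "partial_x (partial_x ?g) z + partial_y (partial_y ?g) z = 0" if "z \<in> S" for z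
  proof -
    \<comment> \<open>The inner partial is first replaced, near \<open>z\<close>, by the linear
      combination from \<open>x\<close>; then linearity applies a second time.\<close>
    have "partial_x (partial_x ?g) z = (\<Sum>i\<in>I. c i *\<^sub>R partial_x (partial_x (f i)) z)"
      using partial_cong(1)[OF \<open>open S\<close> that x] diff that by (simp add: partial_sum_scaleR)
    moreover have "partial_y (partial_y ?g) z = (\<Sum>i\<in>I. c i *\<^sub>R partial_y (partial_y (f i)) z)"
      using partial_cong(2)[OF \<open>open S\<close> that y] diff that by (simp add: partial_sum_scaleR)
    ultimately have "partial_x (partial_x ?g) z + partial_y (partial_y ?g) z =
        (\<Sum>i\<in>I. c i *\<^sub>R (partial_x (partial_x (f i)) z + partial_y (partial_y (f i)) z))"
      by (simp add: sum.distrib scaleR_add_right)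
    also have "\<dots> = 0"
      using harm that by (auto simp: harmonic_on_def intro!: sum.neutral)
    finally show ?thesis .
  qed
  moreover have "C1_on S (partial_x ?g)" "C1_on S (partial_y ?g)"
    using C1_on_cong[OF \<open>open S\<close> x] C1_on_cong[OF \<open>open S\<close> y] C1
    by (simp_all add: C1_on_sum_scaleR)
  ultimately show ?thesis
    using C1 by (simp add: harmonic_on_def C1_on_sum_scaleR)
qed

text \<open>A real-linear map of the plane splits into a complex linear part \<open>l * v\<close>
  and an antilinear part \<open>cnj p * cnj v\<close>. Its values at 1 and \<open>\<i>\<close> are
  \<open>l + cnj p\<close> and \<open>\<i> * (l - cnj p)\<close>, from which the two Wirtinger
  combinations isolate \<open>l\<close> and \<open>cnj p\<close>.\<close>

lemma wirtinger_eqI: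
  assumes "(f has_derivative (\<lambda>v. l * v + cnj (p * v))) (at z)"
  shows "wirtinger f z = l" and "wirtinger_bar f z = cnj p"
  using frechet_derivative_at[OF assms, symmetric]
  by (simp_all add: wirtinger_def wirtinger_bar_def partial_x_def partial_y_def algebra_simps
      flip: mult.assoc)

lemma wirtinger_holomorphic:
  assumes "open S" "f holomorphic_on S" "z \<in> S"
  shows "wirtinger f z = deriv f z"
  using holomorphic_derivI[OF assms(2,1,3)]
  \<comment> \<open>The derivative of a holomorphic function is complex linear: its antilinear part
    is zero.\<close>
  by (intro wirtinger_eqI(1)[where p = 0]) (simp add: has_field_derivative_def)

text \<open>This expresses the dilatation of \<open>f\<close> as the quotient of
  \<open>deriv P z\<close> by \<open>deriv L z\<close>, whichever holomorphic decomposition of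
  \<open>f\<close> is chosen.\<close>

lemma wirtinger_harmonic:
  assumes "open S" "L holomorphic_on S" "P holomorphic_on S" "z \<in> S"
    and eq: "\<And>w. w \<in> S \<Longrightarrow> f w = L w + cnj (P w)"
  shows "wirtinger f z = deriv L z" and "wirtinger_bar f z = cnj (deriv P z)"
proof -
  have "((\<lambda>w. L w + cnj (P w)) has_derivative
      (\<lambda>v. deriv L z * v + cnj (deriv P z * v))) (at z)"
    using holomorphic_derivI[OF assms(2,1,4)] holomorphic_derivI[OF assms(3,1,4)]
    by (intro has_derivative_add has_derivative_cnj) (auto simp: has_field_derivative_def)
  then have "(f has_derivative (\<lambda>v. deriv L z * v + cnj (deriv P z * v))) (at z)"
    using assms by (auto intro: has_derivative_transform_within_open)
  then show "wirtinger f z = deriv L z" and "wirtinger_bar f z = cnj (deriv P z)"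
    by (rule wirtinger_eqI)+
qed

theorem theorem2p5:
  fixes \<Omega> :: "complex set" and n :: nat
    and f :: "nat \<Rightarrow> complex \<Rightarrow> complex" and h :: "nat \<Rightarrow> complex \<Rightarrow> real"
    and a b :: "nat \<Rightarrow> real" and \<nu> :: "complex \<Rightarrow> complex option"
    and X :: "complex \<Rightarrow> complex \<times> real"
  assumes "open \<Omega>" and "connected \<Omega>"
    and enneper: "\<And>i. i \<in> {1..n} \<Longrightarrow> harmonic_enneper_immersion \<Omega> (\<lambda>z. (f i z, h i z))"
    and dilatation: "\<And>i z. i \<in> {1..n} \<Longrightarrow> z \<in> \<Omega> \<Longrightarrow> complex_dilatation (f i) z = \<nu> z"
    and nonzero: "\<exists>z\<in>\<Omega>. (\<Sum>i=1..n. of_real (a i) * f i z) \<noteq> 0"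
    and nondegenerate: "nondegenerate_on \<Omega> (\<lambda>z. \<Sum>i=1..n. of_real (a i) * f i z)"
    and X: "\<And>z. z \<in> \<Omega> \<Longrightarrow> X z = (\<Sum>i=1..n. of_real (a i) * f i z, \<Sum>i=1..n. b i * h i z)"
  shows "harmonic_enneper_immersion \<Omega> X \<and>
    (\<forall>L P.
      (\<forall>i\<in>{1..n}. L i holomorphic_on \<Omega> \<and> P i holomorphic_on \<Omega> \<and>
         (\<forall>z\<in>\<Omega>. f i z = L i z + cnj (P i z))) \<longrightarrow>
      (\<forall>z\<in>\<Omega>. X z =
         ((\<Sum>i=1..n. of_real (a i) * L i z) + (\<Sum>i=1..n. of_real (a i) * cnj (P i z)),
          \<Sum>i=1..n. b i * h i z)))"
proof -
  \<comment> \<open>Each immersion supplies its own pair of holomorphic functions; choice over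
    \<open>i\<close> collects them into two families.\<close>
  have "\<exists>L P. \<forall>i\<in>{1..n}. L i holomorphic_on \<Omega> \<and> P i holomorphic_on \<Omega> \<and>
      (\<forall>z\<in>\<Omega>. f i z = L i z + cnj (P i z)) \<and>
      (\<forall>z\<in>\<Omega>. cmod (wirtinger (L i) z) \<noteq> cmod (wirtinger (P i) z))"
    using enneper unfolding harmonic_enneper_immersion_def fst_conv by metis
  then obtain L P where
    LP: "\<And>i. i \<in> {1..n} \<Longrightarrow> L i holomorphic_on \<Omega>" "\<And>i. i \<in> {1..n} \<Longrightarrow> P i holomorphic_on \<Omega>"
      "\<And>i z. i \<in> {1..n} \<Longrightarrow> z \<in> \<Omega> \<Longrightarrow> f i z = L i z + cnj (P i z)"
      "\<And>i z. i \<in> {1..n} \<Longrightarrow> z \<in> \<Omega> \<Longrightarrow> cmod (wirtinger (L i) z) \<noteq> cmod (wirtinger (P i) z)"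
    by blast
  define A where "A = (\<lambda>z. \<Sum>i=1..n. of_real (a i) * L i z)"
  define B where "B = (\<lambda>z. \<Sum>i=1..n. of_real (a i) * P i z)"
  have hol: "A holomorphic_on \<Omega>" "B holomorphic_on \<Omega>"
    unfolding A_def B_def using LP by (auto intro!: holomorphic_intros)
  \<comment> \<open>The coefficients are real, so conjugation passes through them and the same
    \<open>a i\<close> serve in \<open>A\<close> and in \<open>B\<close>.\<close>
  have split: "(\<Sum>i=1..n. of_real (a i) * f i z) = A z + cnj (B z)" if "z \<in> \<Omega>" for z
    using LP(3) that by (simp add: A_def B_def sum.distrib algebra_simps)
  have "cmod (wirtinger A z) \<noteq> cmod (wirtinger B z)" if z: "z \<in> \<Omega>" for z
  proof -
    have deriv_LP: "(L i has_field_derivative deriv (L i) z) (at z)"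
      "(P i has_field_derivative deriv (P i) z) (at z)" if "i \<in> {1..n}" for i
      using LP(1,2)[OF that] \<open>open \<Omega>\<close> z by (auto intro: holomorphic_derivI)
    have dA: "deriv A z = (\<Sum>i=1..n. of_real (a i) * deriv (L i) z)"
      unfolding A_def using deriv_LP by (intro DERIV_imp_deriv DERIV_sum DERIV_cmult) auto
    have dB: "deriv B z = (\<Sum>i=1..n. of_real (a i) * deriv (P i) z)"
      unfolding B_def using deriv_LP by (intro DERIV_imp_deriv DERIV_sum DERIV_cmult) auto
    have nz: "deriv A z \<noteq> 0 \<or> deriv B z \<noteq> 0"
      using nondegenerate wirtinger_harmonic[OF \<open>open \<Omega>\<close> hol z split] z
      by (auto simp: nondegenerate_on_def)
    have neq: "cmod (deriv (L i) z) \<noteq> cmod (deriv (P i) z)" if "i \<in> {1..n}" for i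
      using LP(4)[OF that z] wirtinger_holomorphic[OF \<open>open \<Omega>\<close> _ z] LP(1,2)[OF that] by simp
    \<comment> \<open>The left side is independent of \<open>i\<close>, so at \<open>z\<close> the
      derivatives of the \<open>L i\<close> either all vanish or are all nonzero; the case split on
      \<open>\<nu> z\<close> below separates these situations.\<close>
    have dil: "\<nu> z = (if deriv (L i) z = 0 then None else Some (deriv (P i) z / deriv (L i) z))"
      if "i \<in> {1..n}" for i
      using dilatation[OF that z, symmetric]
        wirtinger_harmonic[OF \<open>open \<Omega>\<close> LP(1)[OF that] LP(2)[OF that] z LP(3)[OF that]]
      by (simp add: complex_dilatation_def)
    have "cmod (deriv A z) \<noteq> cmod (deriv B z)"
    proof (cases "\<nu> z")
      case None
      then have "deriv (L i) z = 0" if "i \<in> {1..n}" for i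
        using dil[OF that] by (auto split: if_splits)
      then have "deriv A z = 0"
        by (simp add: dA)
      then show ?thesis
        using nz by auto
    next
      case (Some w)
      then have w: "deriv (L i) z \<noteq> 0" "deriv (P i) z = w * deriv (L i) z" if "i \<in> {1..n}" for i
        using dil[OF that] by (auto split: if_splits)
      then have B_eq: "deriv B z = w * deriv A z"
        by (simp add: dA dB sum_distrib_left mult_ac)
      \<comment> \<open>Otherwise \<open>B_eq\<close> would make both derivatives vanish, against
        \<open>nz\<close>.\<close>
      then have "deriv A z \<noteq> 0"
        using nz by auto
      \<comment> \<open>A nonzero sum has a nonempty index set. One index is enough:
        \<open>w\<close> of modulus 1 would give the derivatives of \<open>L i\<close> and
        \<open>P i\<close> equal moduli at \<open>z\<close>.\<close>
      then obtain i where i: "i \<in> {1..n}"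
        unfolding dA by (meson sum.not_neutral_contains_not_neutral)
      have "cmod w \<noteq> 1"
        using neq[OF i] w(2)[OF i] by (auto simp: norm_mult)
      then show ?thesis
        using \<open>deriv A z \<noteq> 0\<close> by (simp add: B_eq norm_mult)
    qed
    then show ?thesis
      using wirtinger_holomorphic[OF \<open>open \<Omega>\<close> _ z] hol by simp
  qed
  moreover have "harmonic_on \<Omega> (\<lambda>z. snd (X z))"
  proof -
    have "harmonic_on \<Omega> (\<lambda>z. \<Sum>i=1..n. b i *\<^sub>R h i z)"
      using enneper
      by (intro harmonic_on_sum_scaleR \<open>open \<Omega>\<close>) (auto simp: harmonic_enneper_immersion_def)
    then show ?thesis
      \<comment> \<open>\<open>X\<close> is prescribed only on \<open>\<Omega>\<close>, so
        harmonicity has to be carried over along equality on an open set.\<close>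
      using harmonic_on_cong[OF \<open>open \<Omega>\<close>, of "\<lambda>z. snd (X z)" "\<lambda>z. \<Sum>i=1..n. b i *\<^sub>R h i z"]
      by (simp add: X)
  qed
  ultimately have "harmonic_enneper_immersion \<Omega> X"
    unfolding harmonic_enneper_immersion_def using hol split by (auto simp: X)
  \<comment> \<open>The formula for \<open>X\<close> concerns arbitrary decompositions, not just the
    families obtained above; it follows by distributing the products over the sums.\<close>
  then show ?thesis
    by (simp add: X sum.distrib algebra_simps)
qed

end
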